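(* Let $(L_d,\mathcal{D}_d,\mathcal{D})$ be an extended discrete nonholonomic Lagrangian system on $\overline{Q}=\mathbb{R}\times Q$ that is autonomous, i.e. $L_d$, $\mathcal{D}_d$ and $\mathcal{D}$ are invariant under the additive action of $\mathbb{R}$ on the time component of $\overline{Q}$. Then the extended discrete Lagrange-d'Alembert (EDLA) algorithm preserves the associated discrete energy: whenever $(t_k,q_k,t_{k+1},q_{k+1})=\Phi(t_{k-1},q_{k-1},t_k,q_k)$, where $\Phi$ is the EDLA map, $$E_{L_d}^+(t_k,q_k,t_{k+1},q_{k+1})=E_{L_d}^+(t_{k-1},q_{k-1},t_k,q_k).$$
   Context: $Q$ is a smooth $n$-dimensional manifold, $\overline{Q}=\mathbb{R}\times Q$ with points $(t,q)$. An extended discrete nonholonomic Lagrangian system is a triple $(L_d,\mathcal{D}_d,\mathcal{D})$ where $L_d:\overline{Q}\times\overline{Q}\to\mathbb{R}$ is a smooth function (discrete Lagrangian), $\mathcal{D}_d\subset\overline{Q}\times\overline{Q}$ is a submanifold (discrete constraint space) and $\mathcal{D}$ is a distribution on $\overline{Q}$, such that $\dim\mathcal{D}_d=\dim\mathcal{D}$ (dimension of $\mathcal{D}$ as a submanifold of $T\overline{Q}$) and $(t,q,t,q)\in\mathcal{D}_d$ for all $(t,q)\in\overline{Q}$. Standing assumption: the constraints impose no condition on time velocities, so that the annihilator $\mathcal{D}^o\subset T^*\overline{Q}$ is locally spanned by one-forms with no $dt$ component, i.e. $\partial/\partial t\in\mathcal{D}$. $D_1,D_2,D_3,D_4$ denote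 the differentials of $L_d(t_0,q_0,t_1,q_1)$ with respect to $t_0,q_0,t_1,q_1$ respectively. The discrete energies are the functions on $\overline{Q}\times\overline{Q}$ $$E_{L_d}^+(t_0,q_0,t_1,q_1)=-D_3L_d(t_0,q_0,t_1,q_1),\qquad E_{L_d}^-(t_0,q_0,t_1,q_1)=D_1L_d(t_0,q_0,t_1,q_1)$$ (they coincide when $L_d$ is invariant under time translations). The additive action of $\mathbb{R}$ on the time component of $\overline{Q}$ is $\psi(s,(t,q))=(s+t,q)$; $L_d$ and $\mathcal{D}_d$ are required to be invariant under the diagonal action on $\overline{Q}\times\overline{Q}$, and $\mathcal{D}$ under the tangent lift of $\psi$. The EDLA equations for $(t_{k-1},q_{k-1}),(t_k,q_k),(t_{k+1},q_{k+1})$ are $$[D_4L_d(t_{k-1},q_{k-1},t_k,q_k)+D_2L_d(t_k,q_k,t_{k+1},q_{k+1})]dq_k+[D_3L_d(t_{k-1},q_{k-1},t_k,q_k)+D_1L_d(t_k,q_k,t_{k+1},q_{k+1})]dt_k\in\mathcal{D}^o_{(t_k,q_k)},$$ $$(t_k,q_k,t_{k+1},q_{k+1})\in\mathcal{D}_d.$$ Standing assumption: the EDLA equations are well posed, i.e. $(t_{k-1},q_{k-1},t_k,q_k)$ determines a unique $(t_{k+1},q_{k+1})$ solving them, giving the EDLA map $\Phi:\overline{Q}\times\overline{Q}\to\overline{Q}\times\overline{Q}$, $\Phi(t_{k-1},q_{k-1},t_k,q_k)=(t_k,q_k,t_{k+1},q_{k+1})$. *)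

theory Defs
  imports "HOL-Analysis.Analysis"
begin

(* Smooth maps on open subsets of finite-dimensional normed spaces.  In finite dimension,
   continuity of all iterated directional derivatives is the usual C^k condition. *)

primrec Ck_on :: "nat \<Rightarrow> 'a::real_normed_vector set \<Rightarrow> ('a \<Rightarrow> 'b::real_normed_vector) \<Rightarrow> bool"
  where
    "Ck_on 0 S f \<longleftrightarrow> continuous_on S f"
  | "Ck_on (Suc k) S f \<longleftrightarrow> (\<forall>x\<in>S. f differentiable (at x)) \<and>
       (\<forall>v. Ck_on k S (\<lambda>x. frechet_derivative f (at x) v))"

definition smooth_on :: "'a::real_normed_vector set \<Rightarrow> ('a \<Rightarrow> 'b::real_normed_vector) \<Rightarrow> bool"
  where "smooth_on S f \<longleftrightarrow> (\<forall>k. Ck_on k S f)"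


(* A chart is a pair of a domain and a coordinate map; the coordinate map is junk outside
   the domain. *)

type_synonym ('a, 'e) chart = "'a set \<times> ('a \<Rightarrow> 'e)"

abbreviation chart_inv :: "('a, 'e) chart \<Rightarrow> 'e \<Rightarrow> 'a"
  where "chart_inv c \<equiv> inv_into (fst c) (snd c)"

definition is_chart :: "('a, 'e::real_normed_vector) chart \<Rightarrow> bool"
  where "is_chart c \<longleftrightarrow> inj_on (snd c) (fst c) \<and> open (snd c ` fst c)"

definition compatible :: "('a, 'e::real_normed_vector) chart \<Rightarrow> ('a, 'e) chart \<Rightarrow> bool"
  where "compatible c d \<longleftrightarrow>
    open (snd c ` (fst c \<inter> fst d)) \<and>
    open (snd d ` (fst c \<inter> fst d)) \<and>
    smooth_on (snd c ` (fst c \<inter> fst d)) (snd d \<circ> chart_inv c) \<and>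
    smooth_on (snd d ` (fst c \<inter> fst d)) (snd c \<circ> chart_inv d)"

(* The charts of the smooth structure (maximal atlas) generated by A. *)
definition smooth_structure :: "('a, 'e::real_normed_vector) chart set \<Rightarrow> ('a, 'e) chart set"
  where "smooth_structure A =
    {c. is_chart c \<and> fst c \<subseteq> (\<Union>d\<in>A. fst d) \<and> (\<forall>d\<in>A. compatible c d)}"

(* The model space is an arbitrary normed space of dimension n, i.e. a copy of R^n.
   The class euclidean_space would exclude n = 0. *)
definition smooth_manifold ::
    "nat \<Rightarrow> ('a::{t2_space, second_countable_topology}, 'e::real_normed_vector) chart set \<Rightarrow> bool"
  where "smooth_manifold n A \<longleftrightarrow>
    (\<exists>B::'e set. finite B \<and> independent B \<and> span B = UNIV \<and> card B = n) \<and>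
    (\<Union>c\<in>A. fst c) = UNIV \<and>
    (\<forall>c\<in>A. open (fst c) \<and> open (snd c ` fst c) \<and>
       homeomorphism (fst c) (snd c ` fst c) (snd c) (chart_inv c)) \<and>
    (\<forall>c\<in>A. \<forall>d\<in>A. compatible c d)"

definition prod_atlas :: "('a, 'e) chart set \<Rightarrow> ('b, 'f) chart set \<Rightarrow> ('a \<times> 'b, 'e \<times> 'f) chart set"
  where "prod_atlas A B =
    (\<lambda>(c, d). (fst c \<times> fst d, map_prod (snd c) (snd d))) ` (A \<times> B)"

(* The atlas of the real line times Q. *)
definition extended_atlas :: "('q, 'e) chart set \<Rightarrow> (real \<times> 'q, real \<times> 'e) chart set"
  where "extended_atlas A = prod_atlas {(UNIV, id)} A"

definition smooth_fun :: "('a, 'e::real_normed_vector) chart set \<Rightarrow> ('a \<Rightarrow> real) \<Rightarrow> bool"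
  where "smooth_fun A f \<longleftrightarrow> (\<forall>c\<in>A. smooth_on (snd c ` fst c) (f \<circ> chart_inv c))"

(* An embedded submanifold of dimension d, by slice charts. *)
definition submanifold :: "('a, 'e::real_normed_vector) chart set \<Rightarrow> nat \<Rightarrow> 'a set \<Rightarrow> bool"
  where "submanifold A d S \<longleftrightarrow>
    S \<subseteq> (\<Union>c\<in>A. fst c) \<and>
    (\<forall>x\<in>S. \<exists>c\<in>smooth_structure A. x \<in> fst c \<and>
       (\<exists>W. subspace W \<and> dim W = d \<and> snd c ` (S \<inter> fst c) = W \<inter> snd c ` fst c))"


(* Tangent vectors are derivations on the smooth functions; they vanish on non-smooth
   functions so that equality of tangent vectors is equality in HOL. *)

type_synonym 'a tvec = "('a \<Rightarrow> real) \<Rightarrow> real"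

definition tangent_space :: "('a, 'e::real_normed_vector) chart set \<Rightarrow> 'a \<Rightarrow> 'a tvec set"
  where "tangent_space A x = {X.
    (\<forall>f. \<not> smooth_fun A f \<longrightarrow> X f = 0) \<and>
    (\<forall>f g. smooth_fun A f \<longrightarrow> smooth_fun A g \<longrightarrow> X (\<lambda>y. f y + g y) = X f + X g) \<and>
    (\<forall>a f. smooth_fun A f \<longrightarrow> X (\<lambda>y. a * f y) = a * X f) \<and>
    (\<forall>f g. smooth_fun A f \<longrightarrow> smooth_fun A g \<longrightarrow>
       X (\<lambda>y. f y * g y) = X f * g x + f x * X g)}"

(* The tangent map of F at any point, into the manifold with atlas B. *)
definition tangent_map ::
    "('b, 'f::real_normed_vector) chart set \<Rightarrow> ('a \<Rightarrow> 'b) \<Rightarrow> 'a tvec \<Rightarrow> 'b tvec"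
  where "tangent_map B F X = (\<lambda>g. if smooth_fun B g then X (g \<circ> F) else 0)"

(* The tangent vector at x whose components in the chart c are w. *)
definition coord_vector ::
    "('a, 'e::real_normed_vector) chart set \<Rightarrow> ('a, 'e) chart \<Rightarrow> 'a \<Rightarrow> 'e \<Rightarrow> 'a tvec"
  where "coord_vector A c x w =
    (\<lambda>f. if smooth_fun A f then frechet_derivative (f \<circ> chart_inv c) (at (snd c x)) w else 0)"

(* The tangent bundle is the set of all (x, X) with X in the tangent space at x;
   these are its natural charts. *)
definition tangent_atlas ::
    "('a, 'e::real_normed_vector) chart set \<Rightarrow> ('a \<times> 'a tvec, 'e \<times> 'e) chart set"
  where "tangent_atlas A =
    (\<lambda>c. ({(x, X). x \<in> fst c \<and> X \<in> tangent_space A x},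
          \<lambda>(x, X). (snd c x, THE w. coord_vector A c x w = X))) ` A"

(* A distribution, given as a subset of the tangent bundle: near every point it is spanned
   by r pointwise independent smooth vector fields, written here in a chart. *)
definition distribution ::
    "('a, 'e::real_normed_vector) chart set \<Rightarrow> ('a \<times> 'a tvec) set \<Rightarrow> bool"
  where "distribution A \<D> \<longleftrightarrow> (\<exists>r. \<forall>x. \<exists>c\<in>smooth_structure A. x \<in> fst c \<and>
    (\<exists>b::nat \<Rightarrow> 'e \<Rightarrow> 'e.
       (\<forall>i<r. smooth_on (snd c ` fst c) (b i)) \<and>
       (\<forall>y\<in>fst c.
          inj_on (\<lambda>i. b i (snd c y)) {..<r} \<and>
          independent ((\<lambda>i. b i (snd c y)) ` {..<r}) \<and>
          {X. (y, X) \<in> \<D>} = coord_vector A c y ` span ((\<lambda>i. b i (snd c y)) ` {..<r}))))"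

(* Covectors at x are functions that are linear on the tangent space; their values
   elsewhere are irrelevant. *)
definition cotangent_space ::
    "('a, 'e::real_normed_vector) chart set \<Rightarrow> 'a \<Rightarrow> ('a tvec \<Rightarrow> real) set"
  where "cotangent_space A x = {\<alpha>.
    (\<forall>X\<in>tangent_space A x. \<forall>Y\<in>tangent_space A x. \<alpha> (\<lambda>f. X f + Y f) = \<alpha> X + \<alpha> Y) \<and>
    (\<forall>X\<in>tangent_space A x. \<forall>a. \<alpha> (\<lambda>f. a * X f) = a * \<alpha> X)}"

definition annihilator ::
    "('a, 'e::real_normed_vector) chart set \<Rightarrow> ('a \<times> 'a tvec) set \<Rightarrow> 'a \<Rightarrow> ('a tvec \<Rightarrow> real) set"
  where "annihilator A \<D> x =
    {\<alpha> \<in> cotangent_space A x. \<forall>X. (x, X) \<in> \<D> \<longrightarrow> \<alpha> X = 0}"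


type_synonym 'q ext = "real \<times> 'q"

(* Here and below, A is an atlas of Q. *)
definition extended_discrete_system ::
    "nat \<Rightarrow> ('q::{t2_space, second_countable_topology}, 'e::real_normed_vector) chart set \<Rightarrow>
     ('q ext \<times> 'q ext \<Rightarrow> real) \<Rightarrow> ('q ext \<times> 'q ext) set \<Rightarrow> ('q ext \<times> 'q ext tvec) set \<Rightarrow> bool"
  where "extended_discrete_system n A L \<D>d \<D> \<longleftrightarrow>
    smooth_manifold n A \<and>
    smooth_fun (prod_atlas (extended_atlas A) (extended_atlas A)) L \<and>
    distribution (extended_atlas A) \<D> \<and>
    (\<exists>d. submanifold (prod_atlas (extended_atlas A) (extended_atlas A)) d \<D>d \<and>
         submanifold (tangent_atlas (extended_atlas A)) d \<D>) \<and>
    (\<forall>t q. ((t, q), (t, q)) \<in> \<D>d)"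

(* The coordinate vector field of the time variable at (t, q). *)
definition d_dt :: "('q, 'e::real_normed_vector) chart set \<Rightarrow> 'q ext \<Rightarrow> 'q ext tvec"
  where "d_dt A = (\<lambda>(t, q) f.
    if smooth_fun (extended_atlas A) f then deriv (\<lambda>s. f (s, q)) t else 0)"

definition no_time_constraint ::
    "('q, 'e::real_normed_vector) chart set \<Rightarrow> ('q ext \<times> 'q ext tvec) set \<Rightarrow> bool"
  where "no_time_constraint A \<D> \<longleftrightarrow> (\<forall>y. (y, d_dt A y) \<in> \<D>)"

definition time_shift :: "real \<Rightarrow> 'q ext \<Rightarrow> 'q ext"
  where "time_shift s = (\<lambda>(t, q). (s + t, q))"

definition autonomous ::
    "('q, 'e::real_normed_vector) chart set \<Rightarrow> ('q ext \<times> 'q ext \<Rightarrow> real) \<Rightarrow>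
     ('q ext \<times> 'q ext) set \<Rightarrow> ('q ext \<times> 'q ext tvec) set \<Rightarrow> bool"
  where "autonomous A L \<D>d \<D> \<longleftrightarrow>
    (\<forall>s y z. L (time_shift s y, time_shift s z) = L (y, z)) \<and>
    (\<forall>s y z. (y, z) \<in> \<D>d \<longrightarrow> (time_shift s y, time_shift s z) \<in> \<D>d) \<and>
    (\<forall>s y X. (y, X) \<in> \<D> \<longrightarrow>
       (time_shift s y, tangent_map (extended_atlas A) (time_shift s) X) \<in> \<D>)"


(* Partial differentials of L in t0, q0, t1, q1.  Those in the time variables are numbers
   (the coefficients of dt); those in q0, q1 are covectors on Q, where the differential
   of a function f sends a tangent vector w to w f. *)

definition D1 :: "('q ext \<times> 'q ext \<Rightarrow> real) \<Rightarrow> 'q ext \<times> 'q ext \<Rightarrow> real"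
  where "D1 L = (\<lambda>((t0, q0), (t1, q1)). deriv (\<lambda>t. L ((t, q0), (t1, q1))) t0)"

definition D2 :: "('q ext \<times> 'q ext \<Rightarrow> real) \<Rightarrow> 'q ext \<times> 'q ext \<Rightarrow> 'q tvec \<Rightarrow> real"
  where "D2 L = (\<lambda>((t0, q0), (t1, q1)) w. w (\<lambda>q. L ((t0, q), (t1, q1))))"

definition D3 :: "('q ext \<times> 'q ext \<Rightarrow> real) \<Rightarrow> 'q ext \<times> 'q ext \<Rightarrow> real"
  where "D3 L = (\<lambda>((t0, q0), (t1, q1)). deriv (\<lambda>t. L ((t0, q0), (t, q1))) t1)"

definition D4 :: "('q ext \<times> 'q ext \<Rightarrow> real) \<Rightarrow> 'q ext \<times> 'q ext \<Rightarrow> 'q tvec \<Rightarrow> real"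
  where "D4 L = (\<lambda>((t0, q0), (t1, q1)) w. w (\<lambda>q. L ((t0, q0), (t1, q))))"

definition energy_plus :: "('q ext \<times> 'q ext \<Rightarrow> real) \<Rightarrow> 'q ext \<times> 'q ext \<Rightarrow> real"
  where "energy_plus L yz = - D3 L yz"

(* dt and dq are the tangent maps of the projections of the product onto its factors,
   the former with values in the real numbers. *)

definition dt :: "'q ext tvec \<Rightarrow> real"
  where "dt X = X fst"

definition dq :: "('q, 'e::real_normed_vector) chart set \<Rightarrow> 'q ext tvec \<Rightarrow> 'q tvec"
  where "dq A X = tangent_map A snd X"

definition EDLA_equations ::
    "('q, 'e::real_normed_vector) chart set \<Rightarrow> ('q ext \<times> 'q ext \<Rightarrow> real) \<Rightarrow>
     ('q ext \<times> 'q ext) set \<Rightarrow> ('q ext \<times> 'q ext tvec) set \<Rightarrow>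
     'q ext \<Rightarrow> 'q ext \<Rightarrow> 'q ext \<Rightarrow> bool"
  where "EDLA_equations A L \<D>d \<D> y0 y1 y2 \<longleftrightarrow>
    (\<lambda>X. (D4 L (y0, y1) (dq A X) + D2 L (y1, y2) (dq A X)) +
         (D3 L (y0, y1) + D1 L (y1, y2)) * dt X)
      \<in> annihilator (extended_atlas A) \<D> y1 \<and>
    (y1, y2) \<in> \<D>d"

definition EDLA_well_posed ::
    "('q, 'e::real_normed_vector) chart set \<Rightarrow> ('q ext \<times> 'q ext \<Rightarrow> real) \<Rightarrow>
     ('q ext \<times> 'q ext) set \<Rightarrow> ('q ext \<times> 'q ext tvec) set \<Rightarrow> bool"
  where "EDLA_well_posed A L \<D>d \<D> \<longleftrightarrow>
    (\<forall>y0 y1. \<exists>!y2. EDLA_equations A L \<D>d \<D> y0 y1 y2)"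

definition EDLA_map ::
    "('q, 'e::real_normed_vector) chart set \<Rightarrow> ('q ext \<times> 'q ext \<Rightarrow> real) \<Rightarrow>
     ('q ext \<times> 'q ext) set \<Rightarrow> ('q ext \<times> 'q ext tvec) set \<Rightarrow>
     'q ext \<times> 'q ext \<Rightarrow> 'q ext \<times> 'q ext"
  where "EDLA_map A L \<D>d \<D> =
    (\<lambda>(y0, y1). (y1, THE y2. EDLA_equations A L \<D>d \<D> y0 y1 y2))"

end

theory Submission
  imports Defs
begin

text \<open>
  Since the time direction lies in the distribution, the EDLA covector vanishes on it; this is
  the time component of the equations, stating that the two discrete energies match across a
  node.  Time invariance makes the Lagrangian depend on the times only through their
  difference, so the two discrete energies agree on each pair of points.
\<close>

text \<open>A derivative at a point of an open set sees only the values inside that set, so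
  agreement on \<open>S\<close> passes to all iterated derivatives. This matters for chart
  representatives, because \<open>chart_inv\<close> is arbitrary off the image of the chart.\<close>

lemma Ck_on_cong:
  assumes "open S" "\<And>x. x \<in> S \<Longrightarrow> f x = g x" "Ck_on k S f"
  shows "Ck_on k S g"
  using assms(2,3)
proof (induction k arbitrary: f g)
  case 0
  then show ?case
    using continuous_on_cong[of S S f g] by simp
next
  case (Suc k)
  have der: "(g has_derivative frechet_derivative f (at x)) (at x)" if "x \<in> S" for x
  proof -
    have "(f has_derivative frechet_derivative f (at x)) (at x)"
      using Suc.prems(2) that by (simp add: frechet_derivative_works)
    then show ?thesis
      using has_derivative_transform_within_open[OF _ \<open>open S\<close> that] Suc.prems(1) by blast
  qed
  then have eq: "frechet_derivative f (at x) v = frechet_derivative g (at x) v" if "x \<in> S" for x v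
    using that by (metis frechet_derivative_at)
  have "g differentiable (at x)" if "x \<in> S" for x
    using der[OF that] by (auto simp: differentiable_def)
  with eq show ?case
    using Suc.IH[of "\<lambda>x. frechet_derivative f (at x) v" "\<lambda>x. frechet_derivative g (at x) v" for v]
      Suc.prems(2) by simp
qed

lemma Ck_on_const: "Ck_on k S (\<lambda>x. c)"
  by (induction k arbitrary: c) simp_all

lemma bounded_linear_imp_smooth_on:
  assumes "bounded_linear f"
  shows "smooth_on S f"
proof -
  have "(f has_derivative f) (at x)" for x
    using assms by (rule bounded_linear_imp_has_derivative)
  then have "f differentiable (at x)" "frechet_derivative f (at x) = f" for x
    by (auto simp: differentiable_def frechet_derivative_at[symmetric])
  \<comment> \<open>A case split replaces induction: every directional derivative of
    \<open>f\<close> is already constant in \<open>x\<close>.\<close>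
  then have "Ck_on k S f" for k
    using assms by (cases k) (simp_all add: linear_continuous_on Ck_on_const)
  then show ?thesis
    by (simp add: smooth_on_def)
qed

text \<open>Tangent vectors are set to 0 on non-smooth functions, so \<open>dt\<close> can take the
  value 1 on \<open>d_dt\<close> only once the time coordinate is known to be smooth.\<close>

lemma smooth_fun_fst:
  assumes "\<And>c. c \<in> A \<Longrightarrow> open (snd c ` fst c)"
  shows "smooth_fun (extended_atlas A) fst"
  unfolding smooth_fun_def
proof
  fix c assume "c \<in> extended_atlas A"
  then obtain d where d: "d \<in> A" and c: "c = (UNIV \<times> fst d, map_prod id (snd d))"
    by (auto simp: extended_atlas_def prod_atlas_def)
  have img: "snd c ` fst c = UNIV \<times> snd d ` fst d"
    by (simp add: c map_prod_surj_on)
  \<comment> \<open>The time factor of \<open>c\<close> is the identity, so inverting the chart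
    leaves the first coordinate unchanged.\<close>
  have "fst y = (fst \<circ> chart_inv c) y" if "y \<in> snd c ` fst c" for y
  proof -
    have "snd c (chart_inv c y) = y"
      using that by (rule f_inv_into_f)
    then show ?thesis
      by (metis c comp_apply fst_map_prod id_apply snd_conv)
  qed
  moreover have "open (snd c ` fst c)"
    unfolding img using assms[OF d] by (simp add: open_Times)
  ultimately show "smooth_on (snd c ` fst c) (fst \<circ> chart_inv c)"
    using bounded_linear_imp_smooth_on[OF bounded_linear_fst] Ck_on_cong
    unfolding smooth_on_def by blast
qed

lemma dt_d_dt:
  assumes "smooth_fun (extended_atlas A) fst"
  shows "dt (d_dt A y) = 1"
  using assms by (simp add: dt_def d_dt_def split: prod.split)

text \<open>A function of the form \<open>g \<circ> snd\<close> is constant in time, so its time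
  derivative is 0; on non-smooth functions 0 is the default value.\<close>

lemma dq_d_dt: "dq A (d_dt A y) = (\<lambda>g. 0)"
  by (auto simp: dq_def tangent_map_def d_dt_def split: prod.split)

lemma smooth_manifold_chart:
  assumes "smooth_manifold n A"
  obtains c where "c \<in> A" "q \<in> fst c" "inj_on (snd c) (fst c)"
proof -
  obtain c where c: "c \<in> A" "q \<in> fst c"
    using assms unfolding smooth_manifold_def by blast
  then have "homeomorphism (fst c) (snd c ` fst c) (snd c) (chart_inv c)"
    using assms unfolding smooth_manifold_def by blast
  then have "inj_on (snd c) (fst c)"
    by (metis homeomorphism_apply1 inj_on_inverseI)
  with c that show thesis by blast
qed

text \<open>Smoothness of \<open>L\<close> is stated only in charts. The chain rule along a curve in
  which only the second time varies turns it into the existence of the derivative that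
  \<open>deriv\<close> denotes in \<open>D3\<close>.\<close>

lemma smooth_fun_differentiable_time:
  fixes L :: "'q::{t2_space, second_countable_topology} ext \<times> 'q ext \<Rightarrow> real"
    and A :: "('q, 'e::real_normed_vector) chart set"
  assumes "smooth_manifold n A"
    and L: "smooth_fun (prod_atlas (extended_atlas A) (extended_atlas A)) L"
  shows "(\<lambda>t. L ((t1, q1), (t, q2))) differentiable (at t2)"
proof -
  obtain c where c: "c \<in> A" "q1 \<in> fst c" "inj_on (snd c) (fst c)"
    using assms(1) by (rule smooth_manifold_chart)
  obtain d where d: "d \<in> A" "q2 \<in> fst d" "inj_on (snd d) (fst d)"
    using assms(1) by (rule smooth_manifold_chart)
  define C where "C = (((UNIV :: real set) \<times> fst c) \<times> ((UNIV :: real set) \<times> fst d),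
    map_prod (map_prod (id :: real \<Rightarrow> real) (snd c)) (map_prod (id :: real \<Rightarrow> real) (snd d)))"
  have "C \<in> prod_atlas (extended_atlas A) (extended_atlas A)"
    using c(1) d(1) unfolding C_def prod_atlas_def extended_atlas_def by force
  then have "Ck_on 1 (snd C ` fst C) (L \<circ> chart_inv C)"
    using L unfolding smooth_fun_def smooth_on_def by blast
  then have diff: "(L \<circ> chart_inv C) differentiable (at (snd C z))" if "z \<in> fst C" for z
    using that by simp
  have inj: "inj_on (snd C) (fst C)"
    using c(3) d(3) by (simp add: C_def map_prod_inj_on)
  \<comment> \<open>This is the curve read in the chart \<open>C\<close>. The time factors carry the
    identity chart, so \<open>p\<close> is affine in \<open>t\<close>.\<close>
  define p where "p t = ((t1, snd c q1), (t, snd d q2))" for t :: real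
  have p: "p t = snd C ((t1, q1), (t, q2))" and C: "((t1, q1), (t, q2)) \<in> fst C" for t
    using c(2) d(2) by (simp_all add: p_def C_def)
  have "p differentiable (at t2)"
    unfolding p_def differentiable_def by (auto intro!: exI derivative_eq_intros)
  moreover have "(L \<circ> chart_inv C) differentiable (at (p t2))"
    unfolding p using C by (rule diff)
  ultimately have "((L \<circ> chart_inv C) \<circ> p) differentiable (at t2)"
    by (rule differentiable_chain_at)
  moreover have "(L \<circ> chart_inv C) \<circ> p = (\<lambda>t. L ((t1, q1), (t, q2)))"
    using inj C by (auto simp: p)
  ultimately show ?thesis
    by simp
qed

lemma D1_eq_minus_D3:
  assumes inv: "\<And>s y z. L (time_shift s y, time_shift s z) = L (y, z)"
    and diff: "(\<lambda>t. L ((t1, q1), (t, q2))) differentiable (at t2)"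
  shows "D1 L ((t1, q1), (t2, q2)) = - D3 L ((t1, q1), (t2, q2))"
proof -
  define h where "h t = L ((t1, q1), (t, q2))" for t
  obtain l where l: "(h has_real_derivative l) (at t2)"
    using diff unfolding h_def by (auto simp: real_differentiable_def)
  \<comment> \<open>Shifting by \<open>t1 - t\<close> restores the first time to \<open>t1\<close>
    and moves the second to \<open>t1 + t2 - t\<close>, which equals \<open>t2\<close> at
    \<open>t = t1\<close>. Varying the first time thus runs \<open>h\<close> backwards, and this is
    where the minus sign arises.\<close>
  have shift: "L ((t, q1), (t2, q2)) = h (t1 + t2 - t)" for t
    using inv[of "t1 - t" "(t, q1)" "(t2, q2)"] by (simp add: time_shift_def h_def algebra_simps)
  have "((\<lambda>t. h (t1 + t2 - t)) has_real_derivative l * (- 1)) (at t1)"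
    by (rule DERIV_chain2[of h]) (use l in \<open>auto intro!: derivative_eq_intros\<close>)
  then have "deriv (\<lambda>t. L ((t, q1), (t2, q2))) t1 = - l"
    by (simp add: shift DERIV_imp_deriv)
  moreover have "deriv (\<lambda>t. L ((t1, q1), (t, q2))) t2 = l"
    using l unfolding h_def by (rule DERIV_imp_deriv)
  ultimately show ?thesis
    by (simp add: D1_def D3_def)
qed

lemma EDLA_equations_of_map:
  assumes "EDLA_well_posed A L \<D>d \<D>" "(y1, y2) = EDLA_map A L \<D>d \<D> (y0, y1)"
  shows "EDLA_equations A L \<D>d \<D> y0 y1 y2"
proof -
  have "\<exists>!y2. EDLA_equations A L \<D>d \<D> y0 y1 y2"
    using assms(1) unfolding EDLA_well_posed_def by blast
  from theI'[OF this] assms(2) show ?thesis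
    by (simp add: EDLA_map_def)
qed

lemma EDLA_time_component:
  assumes "EDLA_equations A L \<D>d \<D> y0 y1 y2" "(y1, d_dt A y1) \<in> \<D>"
    and "smooth_fun (extended_atlas A) fst"
  shows "D3 L (y0, y1) + D1 L (y1, y2) = 0"
proof -
  have "(D4 L (y0, y1) (dq A (d_dt A y1)) + D2 L (y1, y2) (dq A (d_dt A y1))) +
      (D3 L (y0, y1) + D1 L (y1, y2)) * dt (d_dt A y1) = 0"
    using assms(1,2) unfolding EDLA_equations_def annihilator_def by blast
  \<comment> \<open>\<open>D2\<close> and \<open>D4\<close> evaluate their tangent vector on a
    function, so both vanish on the zero vector \<open>dq A (d_dt A y1)\<close>; the time bracket
    remains with factor 1.\<close>
  then show ?thesis
    by (simp add: dq_d_dt dt_d_dt[OF assms(3)] D2_def D4_def split: prod.splits)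
qed

theorem proposition4:
  fixes n :: nat
    and A :: "('q::{t2_space, second_countable_topology}, 'e::real_normed_vector) chart set"
    and L :: "'q ext \<times> 'q ext \<Rightarrow> real"
    and \<D>d :: "('q ext \<times> 'q ext) set"
    and \<D> :: "('q ext \<times> 'q ext tvec) set"
    and t0 t1 t2 :: real
    and q0 q1 q2 :: 'q
  assumes system: "extended_discrete_system n A L \<D>d \<D>"
    and no_time: "no_time_constraint A \<D>"
    and time_invariant: "autonomous A L \<D>d \<D>"
    and well_posed: "EDLA_well_posed A L \<D>d \<D>"
    and step: "((t1, q1), (t2, q2)) = EDLA_map A L \<D>d \<D> ((t0, q0), (t1, q1))"
  shows "energy_plus L ((t1, q1), (t2, q2)) = energy_plus L ((t0, q0), (t1, q1))"
proof -
  have manifold: "smooth_manifold n A"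
    and smooth: "smooth_fun (prod_atlas (extended_atlas A) (extended_atlas A)) L"
    using system unfolding extended_discrete_system_def by blast+
  have "smooth_fun (extended_atlas A) fst"
    using manifold by (intro smooth_fun_fst) (auto simp: smooth_manifold_def)
  then have "D3 L ((t0, q0), (t1, q1)) + D1 L ((t1, q1), (t2, q2)) = 0"
    using EDLA_equations_of_map[OF well_posed step] no_time
    by (intro EDLA_time_component) (auto simp: no_time_constraint_def)
  moreover have "D1 L ((t1, q1), (t2, q2)) = - D3 L ((t1, q1), (t2, q2))"
    using time_invariant smooth_fun_differentiable_time[OF manifold smooth]
    by (intro D1_eq_minus_D3) (auto simp: autonomous_def)
  ultimately show ?thesis
    by (simp add: energy_plus_def)
qed

end
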